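(* Let $H,G$ be two distortion functions, at least twice differentiable. (1) The following conditions are equivalent: (i) $G'(u)/H'(u)$ is decreasing in $[0,1]$; (ii) $R_G(u)\ge R_H(u)$ for all $u\in[0,1]$; (iii) $H\ge_{CX}G$. (2) If any of the conditions (i), (ii), (iii) holds, then $X\ge_H Y$ implies $X\ge_G Y$ (for real random variables $X,Y$ with finite expectations).
   Context: A distortion function is an increasing function $H:[0,1]\to[0,1]$ with $H(0)=0$ and $H(1)=1$. For an at least twice differentiable function $f$, the Arrow–Pratt risk aversion measure is $R_f(u)=-f''(u)/f'(u)$. For cumulative distribution functions (in particular, distortion functions) $F,G$, one says that $F$ is more convex than $G$, written $F\ge_{CX}G$, iff $F\circ G^{-1}$ is convex on $[0,1]$. Here $f^{-1}(p)=\sup\{z: f(z)\le p\}$ denotes the (generalized) inverse. For a real random variable $X$, $F_X$ denotes its cumulative distribution function and $Q_X=F_X^{-1}$ its quantile function. Given a distortion function $H$, $X$ dominates $Y$ with respect to $H$-distorted stochastic dominance, written $X\ge_H Y$, iff $$\int_{-\infty}^x H(F_X(t))\,dt\le\int_{-\infty}^x H(F_Y(t))\,dt\quad\text{for all }x\in\mathbb R,$$ or, equivalently, iff $\int_0^u Q_X(t)\,dH(t)\ge\int_0^u Q_Y(t)\,dH(t)$ for all $u\in[0,1]$.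
   Formalization: It is assumed in addition that H' and G' do not vanish on the open interval (0,1), since otherwise the quotients in (i), (ii) are undefined and (iii) need not imply (2); at the endpoints 0 and 1, (i) and (ii) are required only where the quotients are defined. *)

theory Defs
  imports "HOL-Probability.Probability"
begin

definition distortion :: "(real \<Rightarrow> real) \<Rightarrow> bool" where
  "distortion H \<longleftrightarrow> H \<in> {0..1} \<rightarrow> {0..1} \<and> mono_on {0..1} H \<and> H 0 = 0 \<and> H 1 = 1"

(* Distortion functions live on [0,1]: values outside are irrelevant, and the
   derivatives at 0 and 1 are one-sided. *)
definition deriv01 :: "(real \<Rightarrow> real) \<Rightarrow> real \<Rightarrow> real" where
  "deriv01 f u = vector_derivative f (at u within {0..1})"

definition twice_differentiable01 :: "(real \<Rightarrow> real) \<Rightarrow> bool" where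
  "twice_differentiable01 f \<longleftrightarrow>
     f differentiable_on {0..1} \<and> deriv01 f differentiable_on {0..1}"

(* Meaningful only where deriv01 f u is nonzero (HOL division gives 0 otherwise).
   Distortions such as u^2 have a vanishing derivative at an endpoint, so
   comparisons of such quotients should be restricted to the points of [0,1]
   where all denominators are nonzero. *)
definition arrow_pratt :: "(real \<Rightarrow> real) \<Rightarrow> real \<Rightarrow> real" where
  "arrow_pratt f u = - deriv01 (deriv01 f) u / deriv01 f u"

(* The supremum ranges over the domain [0,1] of f. For a distortion function f
   and p in [0,1] the set contains 0 and is bounded by 1. *)
definition gen_inverse01 :: "(real \<Rightarrow> real) \<Rightarrow> real \<Rightarrow> real" where
  "gen_inverse01 f p = Sup {z \<in> {0..1}. f z \<le> p}"

definition more_convex :: "(real \<Rightarrow> real) \<Rightarrow> (real \<Rightarrow> real) \<Rightarrow> bool" where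
  "more_convex F G \<longleftrightarrow> convex_on {0..1} (F \<circ> gen_inverse01 G)"

definition cdf_of :: "'a measure \<Rightarrow> ('a \<Rightarrow> real) \<Rightarrow> real \<Rightarrow> real" where
  "cdf_of M X = cdf (distr M borel X)"

(* The integrands are nonnegative, so the integrals are taken in [0,\<infinity>]; no
   integrability side condition is needed. X and Y may live on different
   probability spaces, as the order depends on their distributions only. *)
definition distorted_dominates ::
  "(real \<Rightarrow> real) \<Rightarrow> 'a measure \<Rightarrow> ('a \<Rightarrow> real) \<Rightarrow> 'b measure \<Rightarrow> ('b \<Rightarrow> real) \<Rightarrow> bool" where
  "distorted_dominates H M X N Y \<longleftrightarrow>
     (\<forall>x. (\<integral>\<^sup>+ t\<in>{..x}. ennreal (H (cdf_of M X t)) \<partial>lborel)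
        \<le> (\<integral>\<^sup>+ t\<in>{..x}. ennreal (H (cdf_of N Y t)) \<partial>lborel))"

end

theory Submission
  imports Defs
begin

text \<open>
  Write \<open>q = G'/H'\<close>. The Cauchy mean value theorem \<open>G v - G u = q c * (H v - H u)\<close> and
  \<open>q' = q * (R\<^sub>H - R\<^sub>G)\<close> reduce all three conditions to the monotonicity of \<open>q\<close> on the open
  interval. For part (2), set \<open>W v = inf {q c | 0 < c < v}\<close>, an extended nonnegative supergradient of
  \<open>G\<close> as a function of \<open>H\<close>, so that \<open>G u + W v * H v \<le> G v + W v * H u\<close>. As \<open>W \<circ> F\<^sub>Y\<close> is
  decreasing, the inequality of the integrals of \<open>H \<circ> F\<^sub>X\<close> and \<open>H \<circ> F\<^sub>Y\<close> over lower rays survives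
  multiplication by this weight (layer cake), and it remains to integrate and cancel.
\<close>

section \<open>Derivatives on the unit interval\<close>

lemma has_real_derivative_deriv01:
  assumes "f differentiable_on {0..1}" "u \<in> {0..1}"
  shows "(f has_real_derivative deriv01 f u) (at u within {0..1})"
  using assms unfolding deriv01_def differentiable_on_def has_real_derivative_iff_has_vector_derivative
  by (metis vector_derivative_works)

text \<open>All difference quotients inside \<open>T\<close> are nonpositive, and so is their limit.
  \<open>T\<close> may contain or omit either endpoint: it is applied both to the open interval and
  to the set where \<open>deriv01 H\<close> does not vanish.\<close>

lemma antimono_on_imp_deriv_nonpos:
  fixes f :: "real \<Rightarrow> real"
  assumes anti: "antimono_on T f" and T: "{0<..<1} \<subseteq> T" "T \<subseteq> {0..1}" and x: "x \<in> T"
    and der: "(f has_real_derivative D) (at x within {0..1})"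
  shows "D \<le> 0"
proof (rule tendsto_upperbound)
  have "(f has_real_derivative D) (at x within T)"
    using der T(2) by (rule has_field_derivative_subset)
  then show "((\<lambda>y. (f y - f x) / (y - x)) \<longlongrightarrow> D) (at x within T)"
    by (simp add: has_field_derivative_iff)
  show "\<forall>\<^sub>F y in at x within T. (f y - f x) / (y - x) \<le> 0"
    unfolding eventually_at_filter
  proof (intro always_eventually allI impI)
    fix y assume y: "y \<noteq> x" "y \<in> T"
    show "(f y - f x) / (y - x) \<le> 0"
    proof (cases "y < x")
      case True
      then have "f x \<le> f y" using monotone_onD[OF anti y(2) x] by simp
      with True show ?thesis by (simp add: divide_nonneg_neg)
    next
      case False
      then have "f y \<le> f x" using monotone_onD[OF anti x y(2)] by simp
      with False show ?thesis by (simp add: divide_nonpos_nonneg)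
    qed
  qed
  \<comment> \<open>The limit bound needs a nontrivial filter: \<open>x\<close> is approached from
    the right, or from the left if \<open>x = 1\<close>.\<close>
  have "x islimpt {0<..<1::real}"
  proof (cases "x < 1")
    case True
    then have "x islimpt {x<..<1}" by (rule islimpt_greaterThanLessThan1)
    then show ?thesis using x T(2) by (elim islimpt_subset) auto
  next
    case False
    then have "x = 1" using x T(2) by force
    then show ?thesis by (simp add: islimpt_greaterThanLessThan2)
  qed
  then show "at x within T \<noteq> bot"
    using T(1) islimpt_subset trivial_limit_within by blast
qed

section \<open>Monotone weights\<close>

text \<open>A nonempty lower set bounded above is a ray ending at its supremum; whether the endpoint
  belongs to it is a null-set question.\<close>

lemma set_nn_integral_lower_set_mono:
  fixes a b :: "real \<Rightarrow> ennreal"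
  assumes le: "\<And>y. (\<integral>\<^sup>+t\<in>{..y}. a t \<partial>lborel) \<le> (\<integral>\<^sup>+t\<in>{..y}. b t \<partial>lborel)"
    and bdd: "A \<subseteq> {..x}" and lower: "\<And>s t. t \<in> A \<Longrightarrow> s \<le> t \<Longrightarrow> s \<in> A"
  shows "(\<integral>\<^sup>+t\<in>A. a t \<partial>lborel) \<le> (\<integral>\<^sup>+t\<in>A. b t \<partial>lborel)"
proof (cases "A = {}")
  case False
  have bA: "bdd_above A" using bdd by (meson bdd_above_Iic bdd_above_mono)
  have "t \<in> A \<longleftrightarrow> t \<le> Sup A" if "t \<noteq> Sup A" for t
  proof
    assume "t \<le> Sup A"
    with that have "t < Sup A" by simp
    then obtain s where "s \<in> A" "t < s" using less_cSup_iff[OF False bA] by blast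
    then show "t \<in> A" using lower by force
  qed (simp add: cSup_upper bA)
  then have ae: "AE t in lborel. f t * indicator A t = f t * indicator {..Sup A} t"
    for f :: "real \<Rightarrow> ennreal"
    by (intro eventually_mono[OF AE_lborel_singleton[of "Sup A"]]) (auto simp: indicator_def)
  show ?thesis
    using le[of "Sup A"] by (simp only: nn_integral_cong_AE[OF ae])
qed simp

lemma borel_measurable_antimono_ennreal:
  fixes w :: "real \<Rightarrow> ennreal"
  assumes "antimono w"
  shows "w \<in> borel_measurable borel"
proof (rule borel_measurableI_greater)
  fix y
  have "is_interval {t. y < w t}"
    unfolding is_interval_1 using antimonoD[OF assms] by (auto intro: less_le_trans)
  then show "{t \<in> space borel. y < w t} \<in> sets borel"
    by (simp add: is_interval_convex_1 real_interval_borel_measurable is_real_interval)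
qed

text \<open>Layer cake formula for a single value: the interval from 0 to \<open>w\<close> has
  length \<open>w\<close>. The infinite value is covered because the weight \<open>W\<close> below
  attains it.\<close>

lemma nn_integral_layer: "(\<integral>\<^sup>+s. indicator {s. 0 \<le> s \<and> ennreal s < w} s \<partial>lborel) = w"
proof (cases w)
  case (real r)
  then have "{s. 0 \<le> s \<and> ennreal s < w} = {0..<r}" by (auto simp: ennreal_less_iff)
  with real show ?thesis by simp
next
  case top
  then have "{s. 0 \<le> s \<and> ennreal s < w} = {0..}" by auto
  moreover have "emeasure lborel {0::real..} = \<infinity>"
  proof (rule ccontr)
    assume "emeasure lborel {0::real..} \<noteq> \<infinity>"
    then obtain n where n: "emeasure lborel {0::real..} < of_nat n"
      using ennreal_Ex_less_of_nat by (auto simp: less_top)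
    have "of_nat n = emeasure lborel {0..real n}" by (simp add: ennreal_of_nat_eq_real_of_nat)
    also have "\<dots> \<le> emeasure lborel {0::real..}" by (intro emeasure_mono) auto
    finally show False using n by simp
  qed
  ultimately show ?thesis using top by simp
qed

text \<open>By Tonelli, a weighted integral is an integral over levels \<open>s\<close> of
  unweighted integrals over the superlevel sets of \<open>w\<close>. Since \<open>w\<close> is
  decreasing, these are lower sets, where the hypothesis on rays applies.\<close>

lemma set_nn_integral_antimono_weight:
  fixes a b w :: "real \<Rightarrow> ennreal"
  assumes [measurable]: "a \<in> borel_measurable borel" "b \<in> borel_measurable borel"
    and le: "\<And>y. (\<integral>\<^sup>+t\<in>{..y}. a t \<partial>lborel) \<le> (\<integral>\<^sup>+t\<in>{..y}. b t \<partial>lborel)"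
    and w: "antimono w"
  shows "(\<integral>\<^sup>+t\<in>{..x}. w t * a t \<partial>lborel) \<le> (\<integral>\<^sup>+t\<in>{..x}. w t * b t \<partial>lborel)"
proof -
  note [measurable] = borel_measurable_antimono_ennreal[OF w]
  \<comment> \<open>\<open>ennreal\<close> sends negative reals to 0, so without
    \<open>0 \<le> s\<close> all negative levels would be counted wherever
    \<open>w t > 0\<close>.\<close>
  define A where "A s = {t. t \<le> x \<and> 0 \<le> s \<and> ennreal s < w t}" for s
  have layer: "(\<integral>\<^sup>+t\<in>{..x}. w t * f t \<partial>lborel) = (\<integral>\<^sup>+s. (\<integral>\<^sup>+t\<in>A s. f t \<partial>lborel) \<partial>lborel)"
    if [measurable]: "f \<in> borel_measurable borel" for f :: "real \<Rightarrow> ennreal"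
  proof -
    have "(\<integral>\<^sup>+t\<in>{..x}. w t * f t \<partial>lborel) =
        (\<integral>\<^sup>+t. (\<integral>\<^sup>+s. f t * indicator (A s) t \<partial>lborel) \<partial>lborel)"
    proof (rule nn_integral_cong)
      fix t
      have "(\<integral>\<^sup>+s. f t * indicator (A s) t \<partial>lborel) =
          (\<integral>\<^sup>+s. f t * indicator {..x} t * indicator {s. 0 \<le> s \<and> ennreal s < w t} s \<partial>lborel)"
        by (rule nn_integral_cong) (auto simp: A_def indicator_def)
      also have "\<dots> = f t * indicator {..x} t * w t"
        by (subst nn_integral_cmult) (simp_all add: nn_integral_layer)
      finally show "w t * f t * indicator {..x} t = (\<integral>\<^sup>+s. f t * indicator (A s) t \<partial>lborel)"
        by (simp add: mult_ac)
    qed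
    also have "\<dots> = (\<integral>\<^sup>+s. (\<integral>\<^sup>+t\<in>A s. f t \<partial>lborel) \<partial>lborel)"
    proof (rule lborel_pair.Fubini')
      have "(\<lambda>z. f (snd z) * indicator {z. snd z \<le> x \<and> 0 \<le> fst z \<and> ennreal (fst z) < w (snd z)} z)
          \<in> borel_measurable (lborel \<Otimes>\<^sub>M lborel)"
        by measurable
      then show "(\<lambda>(s, t). f t * indicator (A s) t) \<in> borel_measurable (lborel \<Otimes>\<^sub>M lborel)"
        by (simp add: A_def indicator_def case_prod_beta)
    qed
    finally show ?thesis .
  qed
  have "(\<integral>\<^sup>+t\<in>A s. a t \<partial>lborel) \<le> (\<integral>\<^sup>+t\<in>A s. b t \<partial>lborel)" for s
  proof (rule set_nn_integral_lower_set_mono[OF le])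
    show "A s \<subseteq> {..x}" by (auto simp: A_def)
    show "r \<in> A s" if "t \<in> A s" "r \<le> t" for r t
      using that antimonoD[OF w, of r t] by (auto simp: A_def)
  qed
  then show ?thesis by (simp add: layer nn_integral_mono)
qed

section \<open>Pairs of smooth distortion functions\<close>

text \<open>Derivatives may vanish at the endpoints, as for \<open>u^2\<close> at 0, so they are
  nonzero only in the interior.\<close>

locale smooth_distortions =
  fixes H G :: "real \<Rightarrow> real"
  assumes H: "distortion H" and G: "distortion G"
    and smooth_H: "twice_differentiable01 H" and smooth_G: "twice_differentiable01 G"
    and H_nz: "\<forall>u\<in>{0<..<1}. deriv01 H u \<noteq> 0" and G_nz: "\<forall>u\<in>{0<..<1}. deriv01 G u \<noteq> 0"
begin

text \<open>At an endpoint where \<open>deriv01 H\<close> vanishes this is 0 by convention. For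
  \<open>H u = u^2\<close> and \<open>G u = u\<close> that would spoil the monotonicity of
  \<open>1/(2u)\<close>, so such points are excluded below.\<close>

definition q :: "real \<Rightarrow> real" where
  "q u = deriv01 G u / deriv01 H u"

lemma has_deriv:
  assumes "u \<in> {0..1}"
  shows "(H has_real_derivative deriv01 H u) (at u within {0..1})"
    and "(G has_real_derivative deriv01 G u) (at u within {0..1})"
    and "(deriv01 H has_real_derivative deriv01 (deriv01 H) u) (at u within {0..1})"
    and "(deriv01 G has_real_derivative deriv01 (deriv01 G) u) (at u within {0..1})"
  using smooth_H smooth_G assms
  by (auto simp: twice_differentiable01_def intro!: has_real_derivative_deriv01)

lemma has_deriv_interior:
  assumes "u \<in> {0<..<1}"
  shows "(H has_real_derivative deriv01 H u) (at u)"
    and "(G has_real_derivative deriv01 G u) (at u)"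
  using has_deriv(1,2)[of u] assms by (auto simp: at_within_Icc_at)

lemma deriv_nonneg:
  assumes u: "u \<in> {0..1}"
  shows "0 \<le> deriv01 H u" and "0 \<le> deriv01 G u"
proof -
  have "antimono_on {0..1} (\<lambda>u. - H u)" "antimono_on {0..1} (\<lambda>u. - G u)"
    using H G by (auto simp: distortion_def monotone_on_def)
  note this[THEN antimono_on_imp_deriv_nonpos, OF _ _ u]
  from this(1)[OF _ _ DERIV_minus[OF has_deriv(1)[OF u]]]
    this(2)[OF _ _ DERIV_minus[OF has_deriv(2)[OF u]]]
  show "0 \<le> deriv01 H u" "0 \<le> deriv01 G u"
    by (simp_all add: subset_eq)
qed

lemma deriv_pos:
  assumes "u \<in> {0<..<1}"
  shows "0 < deriv01 H u" and "0 < deriv01 G u"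
proof -
  have "u \<in> {0..1}" using assms by simp
  then show "0 < deriv01 H u" "0 < deriv01 G u"
    using deriv_nonneg[of u] H_nz G_nz assms by (simp_all add: less_le)
qed

lemma q_pos: "u \<in> {0<..<1} \<Longrightarrow> 0 < q u"
  by (simp add: q_def deriv_pos)

lemma continuous:
  "continuous_on {0..1} H" "continuous_on {0..1} G"
  by (rule DERIV_continuous_on, erule has_deriv)+

lemma strict:
  assumes "0 \<le> u" "u < v" "v \<le> 1"
  shows "H u < H v" and "G u < G v"
proof -
  have sub: "{u..v} \<subseteq> {0..1}" using assms by auto
  show "H u < H v"
  proof (rule DERIV_pos_imp_increasing_open[OF assms(2) _ continuous_on_subset[OF continuous(1) sub]])
    fix x assume "u < x" "x < v"
    then have "x \<in> {0<..<1}" using assms by auto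
    then show "\<exists>d. (H has_real_derivative d) (at x) \<and> 0 < d"
      using has_deriv_interior(1) deriv_pos(1) by blast
  qed
  show "G u < G v"
  proof (rule DERIV_pos_imp_increasing_open[OF assms(2) _ continuous_on_subset[OF continuous(2) sub]])
    fix x assume "u < x" "x < v"
    then have "x \<in> {0<..<1}" using assms by auto
    then show "\<exists>d. (G has_real_derivative d) (at x) \<and> 0 < d"
      using has_deriv_interior(2) deriv_pos(2) by blast
  qed
qed

lemma cauchy_mvt:
  assumes uv: "0 \<le> u" "u < v" "v \<le> 1"
  obtains c where "u < c" "c < v" "G v - G u = q c * (H v - H u)"
proof -
  \<comment> \<open>Chosen to take equal values at \<open>u\<close> and \<open>v\<close>, so that
    the mean value theorem yields a zero of its derivative.\<close>
  define f where "f = (\<lambda>x. (G v - G u) * H x - (H v - H u) * G x)"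
  have sub: "{u..v} \<subseteq> {0..1}" using uv by auto
  have cont: "continuous_on {u..v} f"
    unfolding f_def
    by (intro continuous_intros continuous(1,2)[THEN continuous_on_subset, OF sub])
  have der: "(f has_real_derivative (G v - G u) * deriv01 H x - (H v - H u) * deriv01 G x) (at x)"
    if "u < x" "x < v" for x
    unfolding f_def using that uv by (auto intro!: derivative_eq_intros has_deriv_interior)
  obtain l c where c: "u < c" "c < v" "(f has_real_derivative l) (at c)" "f v - f u = (v - u) * l"
    using MVT[OF uv(2) cont] der real_differentiable_def by blast
  have "f v - f u = 0" by (simp add: f_def algebra_simps)
  then have "l = 0" using c(4) uv(2) by simp
  moreover have "l = (G v - G u) * deriv01 H c - (H v - H u) * deriv01 G c"
    using DERIV_unique[OF c(3) der[OF c(1,2)]] .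
  moreover have "deriv01 H c > 0" using c uv by (intro deriv_pos) auto
  ultimately have "G v - G u = q c * (H v - H u)"
    by (simp add: q_def field_simps)
  with c show ?thesis using that by blast
qed

section \<open>Risk aversion, monotonicity of \<open>q\<close> and tangents\<close>

lemma q_has_deriv:
  assumes u: "u \<in> {0..1}" and nz: "deriv01 H u \<noteq> 0" "deriv01 G u \<noteq> 0"
  shows "(q has_real_derivative q u * (arrow_pratt H u - arrow_pratt G u)) (at u within {0..1})"
proof -
  have "q u * (arrow_pratt H u - arrow_pratt G u) =
      (deriv01 (deriv01 G) u * deriv01 H u - deriv01 G u * deriv01 (deriv01 H) u) /
      (deriv01 H u * deriv01 H u)"
    using nz by (simp add: q_def arrow_pratt_def field_simps)
  moreover have "q = (\<lambda>u. deriv01 G u / deriv01 H u)" by (auto simp: q_def)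
  ultimately show ?thesis
    using DERIV_divide[OF has_deriv(4)[OF u] has_deriv(3)[OF u] nz(1)] by simp
qed

lemma antimono_imp_arrow_pratt_le:
  assumes anti: "antimono_on T q" and T: "{0<..<1} \<subseteq> T" "T \<subseteq> {0..1}" and u: "u \<in> T"
    and nz: "deriv01 H u \<noteq> 0" "deriv01 G u \<noteq> 0"
  shows "arrow_pratt H u \<le> arrow_pratt G u"
proof -
  have u01: "u \<in> {0..1}" using u T by auto
  have "q u * (arrow_pratt H u - arrow_pratt G u) \<le> 0"
    by (rule antimono_on_imp_deriv_nonpos[OF anti T u q_has_deriv[OF u01 nz]])
  moreover have "q u > 0"
    using deriv_nonneg[OF u01] nz by (simp add: q_def less_le)
  ultimately show ?thesis by (simp add: mult_le_0_iff)
qed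

text \<open>The mean value theorem needs the sign of \<open>q'\<close> only in the interior, plus
  continuity of \<open>q\<close> up to the ends. An endpoint in the domain has
  \<open>deriv01 H\<close> nonzero, so \<open>q\<close> is continuous there; thus interior
  information reaches the endpoints.\<close>

lemma arrow_pratt_le_imp_antimono:
  assumes le: "\<And>u. u \<in> {0<..<1} \<Longrightarrow> arrow_pratt H u \<le> arrow_pratt G u"
  shows "antimono_on {u \<in> {0..1}. deriv01 H u \<noteq> 0} q"
proof (rule monotone_onI)
  fix x y :: real assume x: "x \<in> {u \<in> {0..1}. deriv01 H u \<noteq> 0}" and y: "y \<in> {u \<in> {0..1}. deriv01 H u \<noteq> 0}"
    and xy: "x \<le> y"
  show "q y \<le> q x"
  proof (rule DERIV_nonpos_imp_decreasing_open[OF xy])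
    fix z assume z: "x < z" "z < y"
    then have z01: "z \<in> {0<..<1}" using x y by auto
    then have "(q has_real_derivative q z * (arrow_pratt H z - arrow_pratt G z)) (at z)"
      using q_has_deriv[of z] deriv_pos[of z] by (auto simp: at_within_Icc_at)
    moreover have "q z * (arrow_pratt H z - arrow_pratt G z) \<le> 0"
      using q_pos[OF z01] le[OF z01] by (simp add: mult_nonneg_nonpos)
    ultimately show "\<exists>d. (q has_real_derivative d) (at z) \<and> d \<le> 0" by blast
  next
    have sub: "{x..y} \<subseteq> {0..1}" using x y by auto
    have "continuous_on {0..1} (deriv01 H)" "continuous_on {0..1} (deriv01 G)"
      by (rule DERIV_continuous_on, erule has_deriv)+
    note cont = this[THEN continuous_on_subset, OF sub]
    have "deriv01 H z \<noteq> 0" if "z \<in> {x..y}" for z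
      using that x y H_nz by (cases "z = x"; cases "z = y") auto
    then show "continuous_on {x..y} q"
      unfolding q_def by (intro continuous_on_divide cont) auto
  qed
qed

text \<open>With \<open>H\<close> as coordinate, \<open>G\<close> is concave with slope
  \<open>q v\<close> at \<open>v\<close> and lies below its tangent. On either side of
  \<open>v\<close> the mean slope \<open>q c\<close> is compared with \<open>q v\<close>.\<close>

lemma tangent:
  assumes anti: "antimono_on {0<..<1} q" and v: "v \<in> {0<..<1}" and u: "u \<in> {0..1}"
  shows "q v * (H v - H u) \<le> G v - G u"
proof (cases u v rule: linorder_cases)
  case less
  then obtain c where c: "u < c" "c < v" "G v - G u = q c * (H v - H u)"
    using cauchy_mvt[of u v] u v by auto
  have "q v \<le> q c" using monotone_onD[OF anti, of c v] c u v by auto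
  moreover have "H u < H v" using strict(1)[of u v] less u v by auto
  ultimately show ?thesis using c(3) by simp
next
  case greater
  then obtain c where c: "v < c" "c < u" "G u - G v = q c * (H u - H v)"
    using cauchy_mvt[of v u] u v by auto
  have "q c \<le> q v" using monotone_onD[OF anti, of v c] c u v by auto
  moreover have "H v < H u" using strict(1)[of v u] greater u v by auto
  ultimately have "q c * (H u - H v) \<le> q v * (H u - H v)" by simp
  then show ?thesis using c(3) by (simp add: algebra_simps)
qed simp

section \<open>Convexity of \<open>H\<close> composed with the inverse of \<open>G\<close>\<close>

lemma gen_inverse_left:
  assumes "u \<in> {0..1}"
  shows "gen_inverse01 G (G u) = u"
proof -
  have "{z \<in> {0..1}. G z \<le> G u} = {0..u}"
    using strict(2) assms by (force simp: not_less[symmetric] le_less)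
  then show ?thesis using assms by (simp add: gen_inverse01_def)
qed

lemma image_G: "G ` {0..1} = {0..1}"
proof
  show "G ` {0..1} \<subseteq> {0..1}" using G by (auto simp: distortion_def)
  show "{0..1} \<subseteq> G ` {0..1}"
    using IVT'[of G 0 _ 1] continuous(2) G by (fastforce simp: distortion_def)
qed

lemma gen_inverse:
  assumes "p \<in> {0..1}"
  shows "gen_inverse01 G p \<in> {0..1}" and "G (gen_inverse01 G p) = p"
proof -
  obtain u where "u \<in> {0..1}" "p = G u" using assms image_G by blast
  then show "gen_inverse01 G p \<in> {0..1}" "G (gen_inverse01 G p) = p"
    by (simp_all add: gen_inverse_left)
qed

lemma gen_inverse_interior:
  assumes "p \<in> {0<..<1}"
  shows "gen_inverse01 G p \<in> {0<..<1}"
proof -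
  have "gen_inverse01 G p \<in> {0..1}" "G (gen_inverse01 G p) = p" using gen_inverse[of p] assms by auto
  moreover have "G 0 = 0" "G 1 = 1" using G by (auto simp: distortion_def)
  ultimately show ?thesis using assms by (auto simp: less_le)
qed

text \<open>The tangent inequality, read at \<open>p = G u\<close>, gives the composition a
  supporting line of slope \<open>1 / r\<close> at every interior point, which forces
  convexity.\<close>

lemma antimono_imp_more_convex:
  assumes anti: "antimono_on {0<..<1} q"
  shows "more_convex H G"
  unfolding more_convex_def
proof (rule convex_on_linorderI)
  fix t x z :: real
  assume t: "0 < t" "t < 1" and x: "x \<in> {0..1}" and z: "z \<in> {0..1}" and xz: "x < z"
  define y where "y = (1 - t) * x + t * z"
  let ?K = "H \<circ> gen_inverse01 G"
  have "y - x = t * (z - x)" by (simp add: y_def algebra_simps)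
  then have "x < y" using t xz by (metis diff_gt_0_iff_gt mult_pos_pos)
  have "z - y = (1 - t) * (z - x)" by (simp add: y_def algebra_simps)
  then have "y < z" using t xz by (metis diff_gt_0_iff_gt mult_pos_pos)
  \<comment> \<open>A strict convex combination is interior even if \<open>x\<close> and
    \<open>z\<close> are endpoints, so \<open>q\<close> is positive at its preimage.\<close>
  have y: "y \<in> {0<..<1}" using \<open>x < y\<close> \<open>y < z\<close> x z by simp
  define r where "r = q (gen_inverse01 G y)"
  have r: "r > 0" unfolding r_def by (rule q_pos[OF gen_inverse_interior[OF y]])
  have *: "r * (?K y - ?K p) \<le> y - p" if "p \<in> {0..1}" for p
    using tangent[OF anti gen_inverse_interior[OF y] gen_inverse(1)[OF that]]
      gen_inverse(2)[OF that] gen_inverse(2)[of y] y by (simp add: r_def)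
  \<comment> \<open>With these weights the right-hand sides cancel, \<open>y\<close> being the
    corresponding mean of \<open>x\<close> and \<open>z\<close>.\<close>
  have "(1 - t) * (r * (?K y - ?K x)) + t * (r * (?K y - ?K z)) \<le> (1 - t) * (y - x) + t * (y - z)"
    using t by (intro add_mono mult_left_mono *[OF x] *[OF z]) auto
  also have "\<dots> = 0" by (simp add: y_def algebra_simps)
  finally have "r * (?K y - ((1 - t) * ?K x + t * ?K z)) \<le> 0" by (simp add: algebra_simps)
  with r have "?K y \<le> (1 - t) * ?K x + t * ?K z" by (simp add: mult_le_0_iff)
  then show "?K ((1 - t) *\<^sub>R x + t *\<^sub>R z) \<le> (1 - t) * ?K x + t * ?K z" by (simp add: y_def)
qed simp

lemma gen_inverse_comp_has_deriv:
  assumes u: "u \<in> {0<..<1}"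
  shows "(H \<circ> gen_inverse01 G has_real_derivative inverse (q u)) (at (G u))"
proof -
  let ?p = "G u"
  have gu: "gen_inverse01 G ?p = u" using u by (intro gen_inverse_left) auto
  have p: "0 < ?p" "?p < 1"
    using strict(2)[of 0 u] strict(2)[of u 1] u G by (auto simp: distortion_def)
  \<comment> \<open>The inverse function rule requires continuity of the inverse, which follows from
    compactness of the unit interval.\<close>
  have "continuous_on (G ` {0..1}) (gen_inverse01 G)"
    by (rule continuous_on_inv[OF continuous(2)]) (auto simp: gen_inverse_left)
  then have "continuous_on {0<..<1} (gen_inverse01 G)"
    unfolding image_G by (rule continuous_on_subset) auto
  then have cont: "isCont (gen_inverse01 G) ?p"
    using p by (simp add: continuous_on_eq_continuous_at)
  have "(gen_inverse01 G has_real_derivative inverse (deriv01 G u)) (at ?p)"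
    by (rule DERIV_inverse_function[where f = G and a = 0 and b = 1])
      (use p cont u deriv_pos[OF u] has_deriv_interior[OF u] in \<open>auto simp: gu intro!: gen_inverse(2)\<close>)
  from DERIV_chain[of H "deriv01 H u", OF _ this] show ?thesis
    using has_deriv_interior(1)[OF u] by (simp add: gu q_def divide_inverse mult.commute)
qed

text \<open>The composition has derivative \<open>inverse (q u)\<close> at \<open>G u\<close>, and
  the derivative of a convex function increases.\<close>

lemma more_convex_imp_antimono:
  assumes "more_convex H G"
  shows "antimono_on {0<..<1} q"
proof (rule monotone_onI)
  fix u v :: real assume uv: "u \<in> {0<..<1}" "v \<in> {0<..<1}" "u \<le> v"
  let ?K = "H \<circ> gen_inverse01 G"
  have conv: "convex_on {0..1} ?K" using assms by (simp add: more_convex_def)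
  have G01: "G w \<in> {0<..<1}" if "w \<in> {0<..<1}" for w :: real
    using strict(2)[of 0 w] strict(2)[of w 1] that G by (auto simp: distortion_def)
  have above: "inverse (q w) * (p - G w) \<le> ?K p - ?K (G w)" if "w \<in> {0<..<1}" "p \<in> {0<..<1}" for w p :: real
    by (rule convex_on_imp_above_tangent[OF conv])
      (use that G01[of w] gen_inverse_comp_has_deriv[of w] in
        \<open>auto intro: has_field_derivative_at_within\<close>)
  show "q v \<le> q u"
  proof (cases "u = v")
    case False
    then have "G u < G v" using uv strict(2)[of u v] by auto
    \<comment> \<open>Adding the tangent inequalities at \<open>G u\<close> and at
      \<open>G v\<close>, each evaluated at the other point, cancels the values of
      \<open>?K\<close>.\<close>
    moreover have "(inverse (q u) - inverse (q v)) * (G v - G u) \<le> 0"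
      using above[OF uv(1) G01[OF uv(2)]] above[OF uv(2) G01[OF uv(1)]] by (simp add: algebra_simps)
    ultimately have "inverse (q u) \<le> inverse (q v)" by (simp add: mult_le_0_iff)
    then show ?thesis using q_pos uv by (simp add: inverse_le_iff_le)
  qed simp
qed

section \<open>Transfer of distorted dominance\<close>

text \<open>For \<open>v = 0\<close> the infimum is empty, so \<open>W 0 = \<infinity>\<close>; this is the right supergradient there, as \<open>H 0 = 0\<close>.\<close>

definition W :: "real \<Rightarrow> ennreal" where
  "W v = (INF c\<in>{0<..<v}. ennreal (q c))"

lemma W_antimono: "antimono W"
  unfolding W_def by (intro antimonoI INF_superset_mono) auto

text \<open>Written without subtraction because \<open>W v\<close> may be infinite. The mean value
  point \<open>c\<close> lies below \<open>v\<close> if \<open>u < v\<close>, so \<open>q c\<close>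
  bounds the infimum from above; if \<open>u > v\<close> it lies beyond \<open>v\<close>, so
  monotonicity makes \<open>q c\<close> a lower bound of the family. The infimum also serves at
  \<open>v = 1\<close>, where \<open>q\<close> may be degenerate.\<close>

lemma supergradient:
  assumes anti: "antimono_on {0<..<1} q" and u: "u \<in> {0..1}" and v: "v \<in> {0..1}"
  shows "ennreal (G u) + W v * ennreal (H v) \<le> ennreal (G v) + W v * ennreal (H u)"
proof -
  have nonneg: "0 \<le> H u" "0 \<le> H v" "0 \<le> G u" "0 \<le> G v" using H G u v by (auto simp: distortion_def)
  show ?thesis
  proof (cases u v rule: linorder_cases)
    case less
    then obtain c where c: "u < c" "c < v" "G v - G u = q c * (H v - H u)"
      using cauchy_mvt[of u v] u v by auto
    have d: "0 < H v - H u" using strict(1)[of u v] less u v by auto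
    have q: "0 < q c" using q_pos c u v by auto
    have Gv: "ennreal (G v) = ennreal (G u) + ennreal (q c) * ennreal (H v - H u)"
      using c(3) q d nonneg by (simp flip: ennreal_mult ennreal_plus)
    have Hv: "ennreal (H v) = ennreal (H u) + ennreal (H v - H u)"
      using d nonneg by (simp flip: ennreal_plus)
    have "W v \<le> ennreal (q c)" unfolding W_def using c u by (intro INF_lower) auto
    then have "ennreal (G u) + W v * ennreal (H u) + W v * ennreal (H v - H u) \<le>
        ennreal (G u) + W v * ennreal (H u) + ennreal (q c) * ennreal (H v - H u)"
      by (intro add_left_mono mult_right_mono) auto
    then show ?thesis unfolding Gv Hv by (simp add: distrib_left ac_simps)
  next
    case greater
    then obtain c where c: "v < c" "c < u" "G u - G v = q c * (H u - H v)"
      using cauchy_mvt[of v u] u v by auto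
    have d: "0 < H u - H v" using strict(1)[of v u] greater u v by auto
    have q: "0 < q c" using q_pos c u v by auto
    have Gu: "ennreal (G u) = ennreal (G v) + ennreal (q c) * ennreal (H u - H v)"
      using c(3) q d nonneg by (simp flip: ennreal_mult ennreal_plus)
    have Hu: "ennreal (H u) = ennreal (H v) + ennreal (H u - H v)"
      using d nonneg by (simp flip: ennreal_plus)
    have "ennreal (q c) \<le> W v" unfolding W_def
      using monotone_onD[OF anti, of _ c] c u v by (intro INF_greatest ennreal_leI) auto
    then have "ennreal (G v) + W v * ennreal (H v) + ennreal (q c) * ennreal (H u - H v) \<le>
        ennreal (G v) + W v * ennreal (H v) + W v * ennreal (H u - H v)"
      by (intro add_left_mono mult_right_mono) auto
    then show ?thesis unfolding Gu Hu by (simp add: distrib_left ac_simps)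
  qed simp
qed

lemma dominates_transfer:
  fixes M :: "'a measure" and N :: "'b measure"
  assumes anti: "antimono_on {0<..<1} q"
    and "prob_space M" "prob_space N" and [measurable]: "X \<in> borel_measurable M" "Y \<in> borel_measurable N"
    and dom: "distorted_dominates H M X N Y"
  shows "distorted_dominates G M X N Y"
proof -
  interpret MX: real_distribution "distr M borel X" using assms by (intro prob_space.real_distribution_distr)
  interpret NY: real_distribution "distr N borel Y" using assms by (intro prob_space.real_distribution_distr)
  define FX where "FX = cdf_of M X"
  define FY where "FY = cdf_of N Y"
  have FX: "FX t \<in> {0..1}" "s \<le> t \<Longrightarrow> FX s \<le> FX t" for s t
    unfolding FX_def cdf_of_def
    by (auto simp: MX.cdf_nonneg MX.cdf_bounded_prob MX.cdf_nondecreasing)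
  have FY: "FY t \<in> {0..1}" "s \<le> t \<Longrightarrow> FY s \<le> FY t" for s t
    unfolding FY_def cdf_of_def
    by (auto simp: NY.cdf_nonneg NY.cdf_bounded_prob NY.cdf_nondecreasing)
  have "mono (\<lambda>t. D (F t))" if "distortion D" "\<And>t. F t \<in> {0..1}" "\<And>s t. s \<le> t \<Longrightarrow> F s \<le> F t"
    for D F :: "real \<Rightarrow> real"
    using that by (auto simp: distortion_def monotone_on_def)
  from this[THEN borel_measurable_mono]
  have meas: "(\<lambda>t. ennreal (D (F t))) \<in> borel_measurable borel"
    if "distortion D" "\<And>t. F t \<in> {0..1}" "\<And>s t. s \<le> t \<Longrightarrow> F s \<le> F t" for D F :: "real \<Rightarrow> real"
    using that by measurable
  note [measurable] = meas[OF H FX] meas[OF H FY] meas[OF G FX] meas[OF G FY]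
  \<comment> \<open>\<open>W\<close> decreases and \<open>FY\<close> increases, so the weight
    decreases in \<open>t\<close>, as the weighted comparison demands.\<close>
  have w: "antimono (\<lambda>t. W (FY t))"
    using FY(2) antimonoD[OF W_antimono] by (auto intro!: antimonoI)
  note [measurable] = borel_measurable_antimono_ennreal[OF w]
  show ?thesis
    unfolding distorted_dominates_def FX_def[symmetric] FY_def[symmetric]
  proof
    fix x
    let ?I = "\<lambda>f :: real \<Rightarrow> ennreal. \<integral>\<^sup>+t\<in>{..x}. f t \<partial>lborel"
    let ?GX = "?I (\<lambda>t. ennreal (G (FX t)))" and ?GY = "?I (\<lambda>t. ennreal (G (FY t)))"
    let ?WX = "?I (\<lambda>t. W (FY t) * ennreal (H (FX t)))" and ?WY = "?I (\<lambda>t. W (FY t) * ennreal (H (FY t)))"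
    have weighted: "?WX \<le> ?WY"
      using dom unfolding distorted_dominates_def FX_def[symmetric] FY_def[symmetric]
      by (intro set_nn_integral_antimono_weight w) auto
    \<comment> \<open>The supergradient inequality at \<open>u = 0\<close> bounds \<open>?WY\<close>
      by \<open>?GY\<close>: if \<open>?WY\<close> is infinite, so is \<open>?GY\<close>.\<close>
    have "W (FY t) * ennreal (H (FY t)) \<le> ennreal (G (FY t))" for t
      using supergradient[OF anti _ FY(1), of 0 t] H G by (simp add: distortion_def)
    then have WY_le: "?WY \<le> ?GY" by (intro nn_integral_mono mult_right_mono) auto
    have "?GX + ?WY = ?I (\<lambda>t. ennreal (G (FX t)) + W (FY t) * ennreal (H (FY t)))"
      by (subst nn_integral_add[symmetric]) (auto simp: distrib_right)
    also have "\<dots> \<le> ?I (\<lambda>t. ennreal (G (FY t)) + W (FY t) * ennreal (H (FX t)))"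
      by (intro nn_integral_mono mult_right_mono supergradient anti FX FY) auto
    also have "\<dots> = ?GY + ?WX"
      by (subst nn_integral_add[symmetric]) (auto simp: distrib_right)
    also have "\<dots> \<le> ?GY + ?WY" using weighted by (rule add_left_mono)
    finally have "?WY + ?GX \<le> ?WY + ?GY" by (simp add: add.commute)
    \<comment> \<open>Either \<open>?WY\<close> is finite and cancels, or \<open>?GY\<close> is
      infinite and the bound is trivial.\<close>
    then show "?GX \<le> ?GY"
      using WY_le by (auto simp: ennreal_add_left_cancel_le top_unique)
  qed
qed

end

theorem theorem1:
  fixes H G :: "real \<Rightarrow> real"
  assumes "distortion H" and "distortion G"
    and "twice_differentiable01 H" and "twice_differentiable01 G"
    and "\<forall>u\<in>{0<..<1}. deriv01 H u \<noteq> 0" and "\<forall>u\<in>{0<..<1}. deriv01 G u \<noteq> 0"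
  defines "cond_i \<equiv>
      antimono_on {u \<in> {0..1}. deriv01 H u \<noteq> 0} (\<lambda>u. deriv01 G u / deriv01 H u)"
    and "cond_ii \<equiv>
      (\<forall>u\<in>{0..1}. deriv01 G u \<noteq> 0 \<and> deriv01 H u \<noteq> 0 \<longrightarrow> arrow_pratt G u \<ge> arrow_pratt H u)"
    and "cond_iii \<equiv> more_convex H G"
  shows "((cond_i \<longleftrightarrow> cond_ii) \<and> (cond_ii \<longleftrightarrow> cond_iii)) \<and>
    (cond_i \<or> cond_ii \<or> cond_iii \<longrightarrow>
      (\<forall>(M :: 'a measure) (N :: 'b measure) X Y.
         prob_space M \<and> prob_space N \<and> integrable M X \<and> integrable N Y \<and>
         distorted_dominates H M X N Y \<longrightarrow> distorted_dominates G M X N Y))"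
proof -
  interpret smooth_distortions H G using assms(1-6) by unfold_locales
  define T where "T = {u \<in> {0..1}. deriv01 H u \<noteq> 0}"
  have T: "{0<..<1} \<subseteq> T" "T \<subseteq> {0..1}" using H_nz by (auto simp: T_def)
  have i: "cond_i \<longleftrightarrow> antimono_on T q" by (simp add: cond_i_def T_def q_def[abs_def])
  \<comment> \<open>The hub of the equivalences: here no endpoint conventions interfere.\<close>
  let ?P = "antimono_on {0<..<1} q"
  have "cond_i \<Longrightarrow> ?P" unfolding i using T(1) by (auto intro: monotone_on_subset)
  moreover have "cond_i \<Longrightarrow> cond_ii"
    using antimono_imp_arrow_pratt_le[OF _ T] unfolding i cond_ii_def by (auto simp: T_def)
  moreover have "cond_ii \<Longrightarrow> cond_i"
    using arrow_pratt_le_imp_antimono H_nz G_nz unfolding i T_def cond_ii_def by force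
  \<comment> \<open>The detour through the interior risk aversion inequality extends monotonicity to
    the admissible endpoints.\<close>
  moreover have "?P \<Longrightarrow> cond_i"
    using antimono_imp_arrow_pratt_le[of "{0<..<1}"] arrow_pratt_le_imp_antimono H_nz G_nz
    unfolding i T_def by (metis greaterThanLessThan_subseteq_atLeastAtMost_iff order.refl)
  moreover have "?P \<longleftrightarrow> cond_iii"
    unfolding cond_iii_def using antimono_imp_more_convex more_convex_imp_antimono by blast
  ultimately have eq: "cond_i \<longleftrightarrow> cond_ii" "cond_ii \<longleftrightarrow> cond_iii" "cond_i \<longleftrightarrow> ?P" by blast+
  then show ?thesis using dominates_transfer by blast
qed

end
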